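(* Let $\mathfrak{l}$ be a reductive subalgebra of $\mathfrak{g}$, $\mathfrak{h}$ a Cartan subalgebra of $\mathfrak{g}$ such that $\mathfrak{h}_{\mathfrak{l}}:=\mathfrak{h}\cap\mathfrak{l}$ is a Cartan subalgebra of $\mathfrak{l}$, and $\mathfrak{p}$ a parabolic subalgebra of $\mathfrak{g}$ with $\mathfrak{h}\subseteq\mathfrak{p}$ such that $\mathfrak{p}\cap\mathfrak{l}$ is a parabolic subalgebra of $\mathfrak{l}$. Let $M$ be a $\mathfrak{g}$-module on which $\mathfrak{p}$ acts locally finitely, and let $M_1$ be a nonzero subquotient of $M$. Assume that $\eta|_{\mathfrak{h}_{\mathfrak{l}}}$ is non-integral relative to $\mathfrak{l}$ for all $\eta\in\mathrm{supp}_{\mathfrak{h}}M$. Then $\mathfrak{l}\not\subseteq\mathfrak{g}[M_1]$.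
   Context: $\mathfrak{g}$ is a finite-dimensional complex semisimple Lie algebra. For an $\mathfrak{h}$-module $M$ and $\omega\in\mathfrak{h}^*$, $M^\omega:=\{m\in M: hm=\omega(h)m\ \forall h\in\mathfrak{h}\}$ and $\mathrm{supp}_{\mathfrak{h}}M:=\{\omega\in\mathfrak{h}^*: M^\omega\neq0\}$. A weight of $\mathfrak{h}_{\mathfrak{l}}$ is integral relative to $\mathfrak{l}$ if it pairs integrally with every coroot of $\mathfrak{l}$ with respect to $\mathfrak{h}_{\mathfrak{l}}$. For a $\mathfrak{g}$-module $N$, $\mathfrak{g}[N]$ (the Fernando–Kac subalgebra) is the set of $x\in\mathfrak{g}$ acting locally finitely on $N$. *)

theory Defs
  imports "HOL-Analysis.Analysis"
begin

class complex_vector = ab_group_add +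
  fixes scaleC :: "complex \<Rightarrow> 'a \<Rightarrow> 'a"  (infixr \<open>*\<^sub>C\<close> 75)
  assumes scaleC_add_right: "a *\<^sub>C (x + y) = a *\<^sub>C x + a *\<^sub>C y"
    and scaleC_add_left: "(a + b) *\<^sub>C x = a *\<^sub>C x + b *\<^sub>C x"
    and scaleC_scaleC: "a *\<^sub>C (b *\<^sub>C x) = (a * b) *\<^sub>C x"
    and scaleC_one: "1 *\<^sub>C x = x"

definition cspan :: "'v::complex_vector set \<Rightarrow> 'v set" where
  "cspan S = module.span scaleC S"

definition csubspace :: "'v::complex_vector set \<Rightarrow> bool" where
  "csubspace S = module.subspace scaleC S"

definition fin_dim :: "'v::complex_vector set \<Rightarrow> bool" where
  "fin_dim V \<longleftrightarrow> (\<exists>F. finite F \<and> F \<subseteq> V \<and> cspan F = V)"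

definition set_plus_c :: "'v::complex_vector set \<Rightarrow> 'v set \<Rightarrow> 'v set" where
  "set_plus_c V N = {v + n | v n. v \<in> V \<and> n \<in> N}"

definition lie_algebra :: "('a::complex_vector \<Rightarrow> 'a \<Rightarrow> 'a) \<Rightarrow> bool" where
  "lie_algebra br \<longleftrightarrow>
     (\<forall>x y z. br (x + y) z = br x z + br y z) \<and>
     (\<forall>x y z. br x (y + z) = br x y + br x z) \<and>
     (\<forall>(c::complex) x y. br (c *\<^sub>C x) y = c *\<^sub>C br x y) \<and>
     (\<forall>(c::complex) x y. br x (c *\<^sub>C y) = c *\<^sub>C br x y) \<and>
     (\<forall>x. br x x = 0) \<and>
     (\<forall>x y z. br x (br y z) + br y (br z x) + br z (br x y) = 0)"

definition bracket_set :: "('a::complex_vector \<Rightarrow> 'a \<Rightarrow> 'a) \<Rightarrow> 'a set \<Rightarrow> 'a set \<Rightarrow> 'a set" where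
  "bracket_set br A B = cspan {br x y | x y. x \<in> A \<and> y \<in> B}"

definition lie_subalg :: "('a::complex_vector \<Rightarrow> 'a \<Rightarrow> 'a) \<Rightarrow> 'a set \<Rightarrow> bool" where
  "lie_subalg br S \<longleftrightarrow> csubspace S \<and> (\<forall>x\<in>S. \<forall>y\<in>S. br x y \<in> S)"

definition lie_ideal :: "('a::complex_vector \<Rightarrow> 'a \<Rightarrow> 'a) \<Rightarrow> 'a set \<Rightarrow> 'a set \<Rightarrow> bool" where
  "lie_ideal br L I \<longleftrightarrow> csubspace I \<and> I \<subseteq> L \<and> (\<forall>x\<in>L. \<forall>y\<in>I. br x y \<in> I)"

fun derived_series :: "('a::complex_vector \<Rightarrow> 'a \<Rightarrow> 'a) \<Rightarrow> 'a set \<Rightarrow> nat \<Rightarrow> 'a set" where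
  "derived_series br I 0 = I"
| "derived_series br I (Suc k) = bracket_set br (derived_series br I k) (derived_series br I k)"

fun lower_central_series :: "('a::complex_vector \<Rightarrow> 'a \<Rightarrow> 'a) \<Rightarrow> 'a set \<Rightarrow> nat \<Rightarrow> 'a set" where
  "lower_central_series br I 0 = I"
| "lower_central_series br I (Suc k) = bracket_set br I (lower_central_series br I k)"

definition solvable :: "('a::complex_vector \<Rightarrow> 'a \<Rightarrow> 'a) \<Rightarrow> 'a set \<Rightarrow> bool" where
  "solvable br I \<longleftrightarrow> (\<exists>k. derived_series br I k \<subseteq> {0})"

definition nilpotent :: "('a::complex_vector \<Rightarrow> 'a \<Rightarrow> 'a) \<Rightarrow> 'a set \<Rightarrow> bool" where
  "nilpotent br I \<longleftrightarrow> (\<exists>k. lower_central_series br I k \<subseteq> {0})"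

definition lie_center :: "('a::complex_vector \<Rightarrow> 'a \<Rightarrow> 'a) \<Rightarrow> 'a set \<Rightarrow> 'a set" where
  "lie_center br L = {z \<in> L. \<forall>x\<in>L. br z x = 0}"

definition semisimple :: "('a::complex_vector \<Rightarrow> 'a \<Rightarrow> 'a) \<Rightarrow> 'a set \<Rightarrow> bool" where
  "semisimple br L \<longleftrightarrow> lie_subalg br L \<and> (\<forall>I. lie_ideal br L I \<and> solvable br I \<longrightarrow> I \<subseteq> {0})"

text \<open>Reductive: the radical equals the centre, i.e. every solvable ideal is central.\<close>
definition reductive :: "('a::complex_vector \<Rightarrow> 'a \<Rightarrow> 'a) \<Rightarrow> 'a set \<Rightarrow> bool" where
  "reductive br L \<longleftrightarrow> lie_subalg br L \<and>
     (\<forall>I. lie_ideal br L I \<and> solvable br I \<longrightarrow> I \<subseteq> lie_center br L)"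

definition normalizer :: "('a::complex_vector \<Rightarrow> 'a \<Rightarrow> 'a) \<Rightarrow> 'a set \<Rightarrow> 'a set \<Rightarrow> 'a set" where
  "normalizer br L H = {x \<in> L. \<forall>h\<in>H. br x h \<in> H}"

definition cartan_subalg :: "('a::complex_vector \<Rightarrow> 'a \<Rightarrow> 'a) \<Rightarrow> 'a set \<Rightarrow> 'a set \<Rightarrow> bool" where
  "cartan_subalg br L H \<longleftrightarrow> lie_subalg br H \<and> H \<subseteq> L \<and> nilpotent br H \<and> normalizer br L H = H"

definition borel_subalg :: "('a::complex_vector \<Rightarrow> 'a \<Rightarrow> 'a) \<Rightarrow> 'a set \<Rightarrow> 'a set \<Rightarrow> bool" where
  "borel_subalg br L B \<longleftrightarrow> lie_subalg br B \<and> B \<subseteq> L \<and> solvable br B \<and>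
     (\<forall>B'. lie_subalg br B' \<and> B \<subseteq> B' \<and> B' \<subseteq> L \<and> solvable br B' \<longrightarrow> B' = B)"

definition parabolic_subalg :: "('a::complex_vector \<Rightarrow> 'a \<Rightarrow> 'a) \<Rightarrow> 'a set \<Rightarrow> 'a set \<Rightarrow> bool" where
  "parabolic_subalg br L P \<longleftrightarrow> lie_subalg br P \<and> P \<subseteq> L \<and> (\<exists>B. borel_subalg br L B \<and> B \<subseteq> P)"

definition root_space :: "('a::complex_vector \<Rightarrow> 'a \<Rightarrow> 'a) \<Rightarrow> 'a set \<Rightarrow> 'a set \<Rightarrow> ('a \<Rightarrow> complex) \<Rightarrow> 'a set" where
  "root_space br L H \<alpha> = {x \<in> L. \<forall>h\<in>H. br h x = \<alpha> h *\<^sub>C x}"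

text \<open>Roots of L with respect to H (functionals only matter through their values on H).\<close>
definition is_root :: "('a::complex_vector \<Rightarrow> 'a \<Rightarrow> 'a) \<Rightarrow> 'a set \<Rightarrow> 'a set \<Rightarrow> ('a \<Rightarrow> complex) \<Rightarrow> bool" where
  "is_root br L H \<alpha> \<longleftrightarrow> (\<exists>h\<in>H. \<alpha> h \<noteq> 0) \<and> (\<exists>x \<in> root_space br L H \<alpha>. x \<noteq> 0)"

definition is_coroot :: "('a::complex_vector \<Rightarrow> 'a \<Rightarrow> 'a) \<Rightarrow> 'a set \<Rightarrow> 'a set \<Rightarrow> ('a \<Rightarrow> complex) \<Rightarrow> 'a \<Rightarrow> bool" where
  "is_coroot br L H \<alpha> hc \<longleftrightarrow> hc \<in> H \<and>
     hc \<in> bracket_set br (root_space br L H \<alpha>) (root_space br L H (\<lambda>h. - \<alpha> h)) \<and> \<alpha> hc = 2"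

definition integral_rel :: "('a::complex_vector \<Rightarrow> 'a \<Rightarrow> 'a) \<Rightarrow> 'a set \<Rightarrow> 'a set \<Rightarrow> ('a \<Rightarrow> complex) \<Rightarrow> bool" where
  "integral_rel br L H \<eta> \<longleftrightarrow>
     (\<forall>\<alpha> hc. is_root br L H \<alpha> \<and> is_coroot br L H \<alpha> hc \<longrightarrow> \<eta> hc \<in> \<int>)"

definition lie_module :: "('a::complex_vector \<Rightarrow> 'a \<Rightarrow> 'a) \<Rightarrow> ('a \<Rightarrow> 'm::complex_vector \<Rightarrow> 'm) \<Rightarrow> bool" where
  "lie_module br act \<longleftrightarrow>
     (\<forall>x y m. act (x + y) m = act x m + act y m) \<and>
     (\<forall>(c::complex) x m. act (c *\<^sub>C x) m = c *\<^sub>C act x m) \<and>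
     (\<forall>x m n. act x (m + n) = act x m + act x n) \<and>
     (\<forall>(c::complex) x m. act x (c *\<^sub>C m) = c *\<^sub>C act x m) \<and>
     (\<forall>x y m. act (br x y) m = act x (act y m) - act y (act x m))"

definition submodule :: "('a \<Rightarrow> 'm::complex_vector \<Rightarrow> 'm) \<Rightarrow> 'm set \<Rightarrow> bool" where
  "submodule act N \<longleftrightarrow> csubspace N \<and> (\<forall>x. \<forall>m\<in>N. act x m \<in> N)"

definition weight_support :: "('a \<Rightarrow> 'm::complex_vector \<Rightarrow> 'm) \<Rightarrow> 'a set \<Rightarrow> ('a \<Rightarrow> complex) set" where
  "weight_support act H = {\<omega>. \<exists>m. m \<noteq> 0 \<and> (\<forall>h\<in>H. act h m = \<omega> h *\<^sub>C m)}"

definition acts_locally_finitely :: "('a \<Rightarrow> 'm::complex_vector \<Rightarrow> 'm) \<Rightarrow> 'a set \<Rightarrow> bool" where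
  "acts_locally_finitely act P \<longleftrightarrow>
     (\<forall>m. \<exists>F. finite F \<and> m \<in> cspan F \<and> (\<forall>x\<in>P. \<forall>v\<in>cspan F. act x v \<in> cspan F))"

text \<open>Fernando--Kac subalgebra of the subquotient N1/N2 (N2 \<subseteq> N1 submodules): elements x such
  that every vector of N1/N2 lies in a finite-dimensional x-stable subspace of N1/N2.\<close>
definition fk_subalg_subquot :: "('a \<Rightarrow> 'm::complex_vector \<Rightarrow> 'm) \<Rightarrow> 'm set \<Rightarrow> 'm set \<Rightarrow> 'a set" where
  "fk_subalg_subquot act N1 N2 =
     {x. \<forall>m\<in>N1. \<exists>F. finite F \<and> F \<subseteq> N1 \<and> m \<in> set_plus_c (cspan F) N2 \<and>
          (\<forall>v\<in>cspan F. act x v \<in> set_plus_c (cspan F) N2)}"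

end

theory Submission
  imports Defs "HOL-Computational_Algebra.Fundamental_Theorem_Algebra"
begin

text \<open>
  Suppose \<open>L\<close> acts locally finitely on \<open>N1/N2\<close>. Among the finite-dimensional \<open>H\<close>-stable subspaces of
  \<open>N1\<close> not inside \<open>N2\<close> take a minimal one, \<open>V\<close>. Generalized eigenspaces of elements of the nilpotent
  algebra \<open>H\<close> are \<open>H\<close>-stable, so every \<open>t \<in> H\<close> has a single eigenvalue on \<open>V\<close>; hence any weight \<open>\<eta>\<close>
  of \<open>H\<close> in \<open>V\<close> lies in the support of the module, and \<open>\<eta> t\<close> is an eigenvalue of \<open>t\<close> on \<open>N1/N2\<close>.

  Let \<open>\<alpha>\<close> be a root of \<open>L\<close>, \<open>x\<close> and \<open>y\<close> root vectors for \<open>\<alpha>\<close> and \<open>- \<alpha>\<close>, and \<open>t = [x, y]\<close>; then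
  \<open>t \<in> H \<inter> L\<close>, because \<open>t\<close> normalizes \<open>H \<inter> L\<close>. If \<open>\<alpha> t = 0\<close>, then \<open>x, y, t\<close> satisfy the Heisenberg
  relations and local finiteness forces \<open>\<eta> t = 0\<close>; if \<open>\<alpha> t = 2\<close>, they form an \<open>sl2\<close>-triple and
  \<open>\<eta> t\<close> is an integer. So the form \<open>\<eta> [x, y]\<close> vanishes wherever \<open>\<alpha> [x, y]\<close> does, hence is a multiple
  of it, and \<open>\<eta>\<close> is integral on every coroot, whatever the dimension of the root spaces.
\<close>

section \<open>Polynomials in a linear operator, modulo a subspace\<close>

interpretation cv: vector_space scaleC
  by unfold_locales (simp_all add: scaleC_add_right scaleC_add_left scaleC_scaleC scaleC_one)

abbreviation clin :: "('v::complex_vector \<Rightarrow> 'v) \<Rightarrow> bool" where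
  "clin \<equiv> module_hom scaleC scaleC"

abbreviation stable :: "('v \<Rightarrow> 'v) \<Rightarrow> 'v set \<Rightarrow> bool" where
  "stable T U \<equiv> \<forall>v\<in>U. T v \<in> U"

text \<open>Horner's rule for \<open>p(T) v\<close>; its shape matches \<open>pCons\<close>, so
  identities follow by induction on \<open>p\<close>.\<close>

definition apply_poly :: "('v::complex_vector \<Rightarrow> 'v) \<Rightarrow> complex poly \<Rightarrow> 'v \<Rightarrow> 'v" where
  "apply_poly T p v = fold_coeffs (\<lambda>a w. a *\<^sub>C v + T w) p 0"

lemma csubspace_lemmas:
  assumes "csubspace N"
  shows csubspace_0: "0 \<in> N"
    and csubspace_add: "x \<in> N \<Longrightarrow> y \<in> N \<Longrightarrow> x + y \<in> N"
    and csubspace_diff: "x \<in> N \<Longrightarrow> y \<in> N \<Longrightarrow> x - y \<in> N"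
    and csubspace_scale: "x \<in> N \<Longrightarrow> c *\<^sub>C x \<in> N"
    and csubspace_scale_cancel: "c *\<^sub>C x \<in> N \<Longrightarrow> c \<noteq> 0 \<Longrightarrow> x \<in> N"
  using assms unfolding csubspace_def
  by (auto intro: cv.subspace_0 cv.subspace_add cv.subspace_diff cv.subspace_scale)
    (drule cv.subspace_scale[of _ _ "1 / c"], assumption, simp)

context
  fixes T :: "'v::complex_vector \<Rightarrow> 'v"
  assumes lin: "clin T"
begin

interpretation T: module_hom scaleC scaleC T by (rule lin)

lemma apply_poly_0 [simp]: "apply_poly T 0 v = 0"
  by (simp add: apply_poly_def)

lemma apply_poly_pCons [simp]: "apply_poly T (pCons a p) v = a *\<^sub>C v + T (apply_poly T p v)"
  by (cases "p = 0 \<and> a = 0") (auto simp: apply_poly_def T.zero)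

lemma apply_poly_add: "apply_poly T (p + q) v = apply_poly T p v + apply_poly T q v"
  by (induction p q rule: poly_induct2) (auto simp: cv.scale_left_distrib T.add)

lemma apply_poly_smult: "apply_poly T (smult c p) v = c *\<^sub>C apply_poly T p v"
  by (induction p) (auto simp: cv.scale_right_distrib T.scale)

lemma apply_poly_diff: "apply_poly T (p - q) v = apply_poly T p v - apply_poly T q v"
  using apply_poly_add[of "p - q" q v] by (simp add: algebra_simps)

lemma apply_poly_sum: "apply_poly T (\<Sum>i\<in>A. f i) v = (\<Sum>i\<in>A. apply_poly T (f i) v)"
  by (induction A rule: infinite_finite_induct) (auto simp: apply_poly_add)

lemma apply_poly_monom: "apply_poly T (monom c n) v = c *\<^sub>C (T ^^ n) v"
  by (induction n) (auto simp: monom_Suc monom_0 T.scale T.zero)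

text \<open>\<open>T - a\<close> commutes with polynomials in \<open>T\<close>, so a linear factor
  can be moved onto the vector.\<close>

lemma apply_poly_linear_factor:
  "apply_poly T ([:- a, 1:] * p) v = apply_poly T p (T v - a *\<^sub>C v)"
proof -
  have "T (apply_poly T p v) - a *\<^sub>C apply_poly T p v = apply_poly T p (T v - a *\<^sub>C v)"
    by (induction p) (auto simp: T.add T.scale T.diff T.zero cv.scale_right_distrib
        cv.scale_right_diff_distrib algebra_simps cv.scale_left_commute)
  then show ?thesis
    by (simp add: apply_poly_diff apply_poly_smult apply_poly_add T.zero)
qed

lemma apply_poly_mem:
  assumes "csubspace U" "stable T U" "v \<in> U"
  shows "apply_poly T p v \<in> U"
  using assms by (induction p)
    (auto simp: csubspace_def cv.subspace_0 intro!: cv.subspace_add cv.subspace_scale)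

lemma funpow_mem:
  assumes "stable T U" "v \<in> U"
  shows "(T ^^ k) v \<in> U"
  using assms by (induction k) auto

text \<open>Over the complex numbers an annihilating polynomial can be stripped of its roots one by one.\<close>
lemma annihilated_induct [consumes 2, case_names base step]:
  assumes "p \<noteq> 0" "apply_poly T p v \<in> N"
    and base: "\<And>v c. c \<noteq> 0 \<Longrightarrow> c *\<^sub>C v \<in> N \<Longrightarrow> Q v"
    and step: "\<And>v a. Q (T v - a *\<^sub>C v) \<Longrightarrow> Q v"
  shows "Q v"
  using assms(1,2)
proof (induction "degree p" arbitrary: p v)
  case 0
  then obtain c where "p = [:c:]"
    by (metis degree_eq_zeroE)
  with 0 show ?case
    using base[of c v] by (auto simp: T.zero)
next
  case (Suc n)
  then have "\<not> constant (poly p)"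
    by (simp add: constant_degree)
  then obtain a where "poly p a = 0"
    using fundamental_theorem_of_algebra by blast
  then obtain q where q: "p = [:- a, 1:] * q"
    by (meson poly_eq_0_iff_dvd dvdE)
  with Suc.prems have "q \<noteq> 0"
    by auto
  with q have "degree p = Suc (degree q)"
    using degree_mult_eq[of "[:- a, 1:]" q] by (simp del: mult_pCons_left)
  then have "Q (T v - a *\<^sub>C v)"
    using Suc q \<open>q \<noteq> 0\<close> by (intro Suc.hyps(1)[of q]) (auto simp: apply_poly_linear_factor simp del: mult_pCons_left)
  then show ?case
    by (rule step)
qed

text \<open>Applying the linear factors \<open>T - a\<close> of \<open>p\<close> one after another
  leads from \<open>v\<close> into \<open>N\<close>; the last vector still outside \<open>N\<close>
  is the eigenvector.\<close>

lemma eigenvector_mod: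
  assumes N: "csubspace N" and U: "csubspace U" "stable T U" and v: "v \<in> U" "v \<notin> N"
    and p: "p \<noteq> 0" "apply_poly T p v \<in> N"
  obtains u a where "u \<in> U" "u \<notin> N" "T u - a *\<^sub>C u \<in> N"
proof -
  have "v \<in> U - N \<longrightarrow> (\<exists>u a. u \<in> U \<and> u \<notin> N \<and> T u - a *\<^sub>C u \<in> N)"
    using p
  proof (induction rule: annihilated_induct)
    case (base v c)
    then have "(1 / c) *\<^sub>C (c *\<^sub>C v) \<in> N"
      using N unfolding csubspace_def by (metis cv.subspace_scale)
    with base show ?case by simp
  next
    case (step v a)
    moreover have "T v - a *\<^sub>C v \<in> U" if "v \<in> U"
      using U that unfolding csubspace_def
      by (auto intro!: cv.subspace_diff cv.subspace_scale)
    ultimately show ?case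
      by blast
  qed
  with v that show ?thesis
    by blast
qed

text \<open>Modulo \<open>N\<close>, the first \<open>card F + 1\<close> iterates of
  \<open>v\<close> are represented by vectors of \<open>cspan F\<close>. These satisfy a linear
  relation, whose coefficients form the polynomial.\<close>

lemma annihilator_exists:
  assumes F: "finite F" and N: "csubspace N"
    and v: "\<And>k. (T ^^ k) v \<in> set_plus_c (cspan F) N"
  obtains p where "p \<noteq> 0" "apply_poly T p v \<in> N"
proof -
  have "\<exists>f. f \<in> cspan F \<and> (T ^^ k) v - f \<in> N" for k
    using v[of k] by (auto simp: set_plus_c_def)
  then obtain f where f: "f k \<in> cspan F" "(T ^^ k) v - f k \<in> N" for k
    by metis
  define n where "n = card F"
  \<comment> \<open>Dependence of the image set only gives a relation between distinct vectors; if
    \<open>f\<close> repeats a value, the difference of the two equal terms is the relation.\<close>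
  obtain c i where c: "i \<le> n" "c i \<noteq> 0" "(\<Sum>k\<le>n. c k *\<^sub>C f k) = 0"
  proof (cases "inj_on f {..n}")
    case True
    then have "card (f ` {..n}) > card F"
      by (simp add: card_image n_def)
    then have "cv.dependent (f ` {..n})"
      using cv.independent_span_bound[OF F, of "f ` {..n}"] f(1)
      by (force simp: cspan_def)
    then obtain u x where u: "x \<in> f ` {..n}" "u x \<noteq> 0" "(\<Sum>x\<in>f ` {..n}. u x *\<^sub>C x) = 0"
      by (auto simp: cv.dependent_finite)
    with True show ?thesis
      by (auto simp: sum.reindex intro!: that[of _ "u \<circ> f"])
  next
    case False
    then obtain i j where ij: "i \<le> n" "j \<le> n" "i \<noteq> j" "f i = f j"
      by (auto simp: inj_on_def)
    define c :: "nat \<Rightarrow> complex" where "c = (\<lambda>k. if k = i then 1 else if k = j then - 1 else 0)"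
    have "(\<Sum>k\<le>n. c k *\<^sub>C f k) = (\<Sum>k\<in>{i, j}. c k *\<^sub>C f k)"
      using ij by (intro sum.mono_neutral_right) (auto simp: c_def)
    also have "\<dots> = 0"
      using ij by (simp add: c_def)
    finally show ?thesis
      using ij by (intro that[of i c]) (auto simp: c_def)
  qed
  define p where "p = (\<Sum>k\<le>n. monom (c k) k)"
  have "coeff p i = c i"
    using c(1) by (simp add: p_def coeff_sum if_distrib cong: if_cong)
  then have "p \<noteq> 0"
    using c(2) by auto
  moreover have "apply_poly T p v = (\<Sum>k\<le>n. c k *\<^sub>C (T ^^ k) v) - (\<Sum>k\<le>n. c k *\<^sub>C f k)"
    using c(3) by (simp add: p_def apply_poly_sum apply_poly_monom)
  then have "apply_poly T p v = (\<Sum>k\<le>n. c k *\<^sub>C ((T ^^ k) v - f k))"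
    by (simp add: sum_subtractf cv.scale_right_diff_distrib)
  then have "apply_poly T p v \<in> N"
    using f(2) N by (auto simp: csubspace_def intro!: cv.subspace_sum cv.subspace_scale)
  ultimately show ?thesis
    by (rule that)
qed

end


section \<open>Heisenberg and sl2 relations modulo a subspace\<close>

text \<open>Congruences modulo \<open>N\<close> stand in for a quotient module; local finiteness on
  the class of \<open>v\<close> enters only as an annihilating polynomial.\<close>

definition algebraic_mod :: "('v::complex_vector \<Rightarrow> 'v) \<Rightarrow> 'v set \<Rightarrow> 'v \<Rightarrow> bool" where
  "algebraic_mod T N v \<longleftrightarrow> (\<exists>p. p \<noteq> 0 \<and> apply_poly T p v \<in> N)"

text \<open>Take an eigenvector \<open>u\<close> of \<open>X\<close> modulo \<open>N\<close>. If
  \<open>p(Y)\<close> sends \<open>u\<close> into \<open>N\<close>, so does the derivative of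
  \<open>p\<close>, as \<open>c\<close> is nonzero. In characteristic zero this descends to a
  nonzero constant, which cannot send \<open>u\<close> into \<open>N\<close>.\<close>

lemma heisenberg_contradiction:
  assumes X: "clin X" and Y: "clin Y" and N: "csubspace N" "stable X N" "stable Y N"
    and U: "csubspace U" "stable X U" "stable Y U"
    and v: "v \<in> U" "v \<notin> N"
    and alg: "algebraic_mod X N v" "\<And>w. w \<in> U \<Longrightarrow> algebraic_mod Y N w"
    and comm: "\<And>w. w \<in> U \<Longrightarrow> X (Y w) - Y (X w) - c *\<^sub>C w \<in> N"
    and c: "c \<noteq> 0"
  shows False
proof -
  interpret X: module_hom scaleC scaleC X by (rule X)
  interpret Y: module_hom scaleC scaleC Y by (rule Y)
  obtain u a where u: "u \<in> U" "u \<notin> N" "X u - a *\<^sub>C u \<in> N"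
    using alg(1) eigenvector_mod[OF X N(1) U(1,2) v] unfolding algebraic_mod_def by metis
  text \<open>Modulo \<open>N\<close>, the operator \<open>X - a\<close> acts on polynomials in \<open>Y\<close> applied to \<open>u\<close> as \<open>c d/dY\<close>.\<close>
  have deriv: "X (apply_poly Y q u) - a *\<^sub>C apply_poly Y q u - c *\<^sub>C apply_poly Y (pderiv q) u \<in> N" for q
  proof (induction q)
    case 0
    then show ?case
      using Y N by (simp add: csubspace_0 X.zero)
  next
    case (pCons b q)
    define w where "w = apply_poly Y q u"
    define w' where "w' = apply_poly Y (pderiv q) u"
    have "w \<in> U"
      unfolding w_def by (rule apply_poly_mem[OF Y U(1,3) u(1)])
    then have "b *\<^sub>C (X u - a *\<^sub>C u) + (X (Y w) - Y (X w) - c *\<^sub>C w) + Y (X w - a *\<^sub>C w - c *\<^sub>C w') \<in> N"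
      using N u(3) comm pCons.IH by (auto simp: w_def w'_def intro!: csubspace_add csubspace_scale)
    also have "b *\<^sub>C (X u - a *\<^sub>C u) + (X (Y w) - Y (X w) - c *\<^sub>C w) + Y (X w - a *\<^sub>C w - c *\<^sub>C w')
        = X (b *\<^sub>C u + Y w) - a *\<^sub>C (b *\<^sub>C u + Y w) - c *\<^sub>C (w + Y w')"
      by (simp add: X.add X.scale Y.add Y.diff Y.scale cv.scale_right_distrib
          cv.scale_right_diff_distrib algebra_simps)
    finally show ?case
      using Y by (simp add: w_def w'_def pderiv_pCons apply_poly_add)
  qed
  obtain p where "p \<noteq> 0" "apply_poly Y p u \<in> N"
    using alg(2)[OF u(1)] unfolding algebraic_mod_def by blast
  then show False
  proof (induction "degree p" arbitrary: p rule: less_induct)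
    case less
    show False
    proof (cases "degree p = 0")
      case True
      then obtain b where "p = [:b:]"
        by (metis degree_eq_zeroE)
      with less.prems show False
        using Y u(2) csubspace_scale_cancel[OF N(1), of b u] by (simp add: Y.zero)
    next
      case False
      have "(X (apply_poly Y p u) - a *\<^sub>C apply_poly Y p u)
          - (X (apply_poly Y p u) - a *\<^sub>C apply_poly Y p u - c *\<^sub>C apply_poly Y (pderiv p) u) \<in> N"
        using N less.prems(2)
        by (intro csubspace_diff[OF N(1) _ deriv[of p]] csubspace_diff[OF N(1)] csubspace_scale) auto
      then have "apply_poly Y (pderiv p) u \<in> N"
        using csubspace_scale_cancel[OF N(1)] c by simp
      with False show False
        by (intro less.hyps[of "pderiv p"]) (auto simp: degree_pderiv pderiv_eq_0_iff)
    qed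
  qed
qed

lemma weight_shift_funpow:
  assumes E: "clin E" and K: "clin K" and N: "csubspace N" "stable E N"
    and comm: "\<And>w. K (E w) - E (K w) = \<delta> *\<^sub>C E w"
    and v: "K v - \<mu> *\<^sub>C v \<in> N"
  shows "K ((E ^^ k) v) - (\<mu> + of_nat k * \<delta>) *\<^sub>C (E ^^ k) v \<in> N"
proof (induction k)
  case 0
  then show ?case using v by simp
next
  case (Suc k)
  interpret E: module_hom scaleC scaleC E by (rule E)
  let ?w = "(E ^^ k) v"
  have "E (K ?w - (\<mu> + of_nat k * \<delta>) *\<^sub>C ?w) \<in> N"
    using Suc N by blast
  also have "E (K ?w - (\<mu> + of_nat k * \<delta>) *\<^sub>C ?w) = K (E ?w) - (\<mu> + of_nat (Suc k) * \<delta>) *\<^sub>C E ?w"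
    using comm[of ?w] by (simp add: E.diff E.add E.scale scaleC_add_left algebra_simps)
  finally show ?case
    by simp
qed

text \<open>Modulo \<open>N\<close>, the vectors \<open>(E ^^ k) v\<close> belong to the pairwise
  distinct eigenvalues \<open>\<mu> + k \<delta>\<close> of \<open>K\<close>, so an annihilating
  polynomial in \<open>E\<close> can be reduced to a monomial.\<close>

lemma weight_shift_nilpotent:
  assumes E: "clin E" and K: "clin K" and N: "csubspace N" "stable E N" "stable K N"
    and comm: "\<And>w. K (E w) - E (K w) = \<delta> *\<^sub>C E w" and \<delta>: "\<delta> \<noteq> 0"
    and v: "K v - \<mu> *\<^sub>C v \<in> N" and alg: "algebraic_mod E N v"
  obtains k where "(E ^^ k) v \<in> N"
proof -
  interpret E: module_hom scaleC scaleC E by (rule E)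
  interpret K: module_hom scaleC scaleC K by (rule K)
  text \<open>Modulo \<open>N\<close>, the operator \<open>K - \<mu>\<close> acts on polynomials in \<open>E\<close> applied to \<open>v\<close> as \<open>\<delta> E d/dE\<close>.\<close>
  have euler: "K (apply_poly E q v) - \<mu> *\<^sub>C apply_poly E q v - \<delta> *\<^sub>C E (apply_poly E (pderiv q) v) \<in> N" for q
  proof (induction q)
    case 0
    then show ?case
      using E N by (simp add: csubspace_0 K.zero E.zero)
  next
    case (pCons b q)
    define w where "w = apply_poly E q v"
    define w' where "w' = apply_poly E (pderiv q) v"
    have "b *\<^sub>C (K v - \<mu> *\<^sub>C v) + E (K w - \<mu> *\<^sub>C w - \<delta> *\<^sub>C E w') \<in> N"
      using N v pCons.IH by (auto simp: w_def w'_def intro!: csubspace_add csubspace_scale)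
    also have "b *\<^sub>C (K v - \<mu> *\<^sub>C v) + E (K w - \<mu> *\<^sub>C w - \<delta> *\<^sub>C E w')
        = K (b *\<^sub>C v + E w) - \<mu> *\<^sub>C (b *\<^sub>C v + E w) - \<delta> *\<^sub>C E (w + E w')"
      using comm[of w]
      by (simp add: K.add K.scale E.add E.diff E.scale cv.scale_right_distrib cv.scale_right_diff_distrib
          algebra_simps)
    finally show ?case
      using E by (simp add: w_def w'_def pderiv_pCons apply_poly_add)
  qed
  obtain p where "p \<noteq> 0" "apply_poly E p v \<in> N"
    using alg unfolding algebraic_mod_def by blast
  then have "\<exists>k. (E ^^ k) v \<in> N"
  proof (induction "degree p" arbitrary: p rule: less_induct)
    case less
    define n where "n = degree p"
    \<comment> \<open>With t as variable, q = t p' - n p multiplies the coefficient of t^i by i - n.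
      It still annihilates \<open>v\<close> modulo \<open>N\<close>, loses the leading term, and
      vanishes only if \<open>p\<close> is a monomial.\<close>
    define q where "q = pCons 0 (pderiv p) - smult (of_nat n) p"
    have coeff_q: "coeff q i = (of_nat i - of_nat n) * coeff p i" for i
      by (cases i) (auto simp: q_def coeff_pderiv algebra_simps)
    have "(K (apply_poly E p v) - \<mu> *\<^sub>C apply_poly E p v)
        - (K (apply_poly E p v) - \<mu> *\<^sub>C apply_poly E p v - \<delta> *\<^sub>C E (apply_poly E (pderiv p) v)) \<in> N"
      using N less.prems(2)
      by (intro csubspace_diff[OF N(1) _ euler[of p]] csubspace_diff[OF N(1)] csubspace_scale) auto
    then have "E (apply_poly E (pderiv p) v) \<in> N"
      using csubspace_scale_cancel[OF N(1)] \<delta> by simp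
    then have qv: "apply_poly E q v \<in> N"
      using E N less.prems(2) unfolding q_def
      by (auto simp: apply_poly_diff apply_poly_smult intro!: csubspace_diff csubspace_scale)
    show ?case
    proof (cases "q = 0")
      case True
      then have "coeff p i = 0" if "i \<noteq> n" for i
        using coeff_q[of i] that by auto
      then have "p = monom (lead_coeff p) n"
        by (auto simp: poly_eq_iff n_def)
      then have "lead_coeff p *\<^sub>C (E ^^ n) v \<in> N"
        using less.prems(2) apply_poly_monom[OF E] by metis
      then show ?thesis
        using csubspace_scale_cancel[OF N(1)] less.prems(1) by fastforce
    next
      case False
      have "degree q \<le> n"
        by (rule degree_le) (simp add: coeff_q n_def coeff_eq_0)
      moreover have "coeff q n = 0"
        by (simp add: coeff_q)
      ultimately have "degree q < n"
        using False by (metis le_neq_implies_less leading_coeff_0_iff)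
      with False qv less.hyps show ?thesis
        by (auto simp: n_def)
    qed
  qed
  with that show ?thesis
    by blast
qed

lemma last_outside:
  assumes "v \<notin> N" "(E ^^ k) v \<in> N"
  obtains j where "(E ^^ j) v \<notin> N" "E ((E ^^ j) v) \<in> N"
  using assms
proof (induction k)
  case (Suc k)
  then show ?case by (cases "(E ^^ k) v \<in> N") auto
qed auto

text \<open>Raise \<open>v\<close> to a highest weight vector \<open>w\<close> modulo
  \<open>N\<close>, of weight \<mu> = c + 2j, and lower it to the last \<open>(F ^^ n) w\<close>
  outside \<open>N\<close>. Since E F^(n+1) w = (n+1)(\<mu> - n) F^n w modulo \<open>N\<close>, it
  follows that \<mu> = n.\<close>

lemma sl2_eigenvalue_integral:
  assumes E: "clin E" and F: "clin F" and K: "clin K"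
    and N: "csubspace N" "stable E N" "stable F N" "stable K N"
    and U: "stable E U" "stable F U"
    and EF: "\<And>w. E (F w) - F (E w) = K w"
    and KE: "\<And>w. K (E w) - E (K w) = 2 *\<^sub>C E w"
    and KF: "\<And>w. K (F w) - F (K w) = (- 2) *\<^sub>C F w"
    and alg: "\<And>w. w \<in> U \<Longrightarrow> algebraic_mod E N w" "\<And>w. w \<in> U \<Longrightarrow> algebraic_mod F N w"
    and v: "v \<in> U" "v \<notin> N" "K v - c *\<^sub>C v \<in> N"
  shows "c \<in> \<int>"
proof -
  interpret E: module_hom scaleC scaleC E by (rule E)
  interpret F: module_hom scaleC scaleC F by (rule F)
  obtain k where "(E ^^ k) v \<in> N"
    using weight_shift_nilpotent[OF E K N(1,2,4) KE _ v(3) alg(1)[OF v(1)]] by auto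
  then obtain j where j: "(E ^^ j) v \<notin> N" "E ((E ^^ j) v) \<in> N"
    using v(2) last_outside by metis
  define w where "w = (E ^^ j) v"
  define \<mu> where "\<mu> = c + of_nat j * 2"
  have w: "w \<in> U" "w \<notin> N" "E w \<in> N" "K w - \<mu> *\<^sub>C w \<in> N"
    using j funpow_mem[OF E U(1) v(1)] weight_shift_funpow[OF E K N(1,2) KE v(3)]
    by (auto simp: w_def \<mu>_def)
  obtain k where "(F ^^ k) w \<in> N"
    using weight_shift_nilpotent[OF F K N(1,3,4) KF _ w(4) alg(2)[OF w(1)]] by auto
  then obtain n where n: "(F ^^ n) w \<notin> N" "F ((F ^^ n) w) \<in> N"
    using w(2) last_outside by metis
  have "E (F ((F ^^ i) w)) - ((of_nat i + 1) * (\<mu> - of_nat i)) *\<^sub>C (F ^^ i) w \<in> N" for i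
  proof (induction i)
    case 0
    have "F (E w) + (K w - \<mu> *\<^sub>C w) \<in> N"
      using w N by (auto intro!: csubspace_add)
    then show ?case
      using EF[of w] by (simp add: algebra_simps)
  next
    case (Suc i)
    let ?u = "(F ^^ i) w"
    have "F (E (F ?u) - ((of_nat i + 1) * (\<mu> - of_nat i)) *\<^sub>C ?u)
       + (K (F ?u) - (\<mu> + of_nat (Suc i) * (- 2)) *\<^sub>C F ?u) \<in> N"
      using Suc N weight_shift_funpow[OF F K N(1,3) KF w(4), of "Suc i"]
      by (auto intro!: csubspace_add)
    also have "F (E (F ?u) - ((of_nat i + 1) * (\<mu> - of_nat i)) *\<^sub>C ?u)
       + (K (F ?u) - (\<mu> + of_nat (Suc i) * (- 2)) *\<^sub>C F ?u)
      = (F (E (F ?u)) + K (F ?u))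
       - ((of_nat i + 1) * (\<mu> - of_nat i) + (\<mu> + of_nat (Suc i) * (- 2))) *\<^sub>C F ?u"
      by (simp only: F.diff F.scale scaleC_add_left) (simp add: algebra_simps)
    also have "(of_nat i + 1) * (\<mu> - of_nat i) + (\<mu> + of_nat (Suc i) * (- 2))
      = (of_nat (Suc i) + 1) * (\<mu> - of_nat (Suc i))"
      by (simp add: algebra_simps)
    also have "F (E (F ?u)) + K (F ?u) = E (F (F ?u))"
      using EF[of "F ?u"] by (simp add: algebra_simps)
    finally show ?case
      by simp
  qed
  note shift = this
  have "(E (F ((F ^^ n) w)))
      - (E (F ((F ^^ n) w)) - ((of_nat n + 1) * (\<mu> - of_nat n)) *\<^sub>C (F ^^ n) w) \<in> N"
    using N by (intro csubspace_diff[OF N(1) _ shift[of n]]) (use n(2) in auto)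
  then have "(of_nat n + 1) * (\<mu> - of_nat n) = 0"
    using csubspace_scale_cancel[OF N(1)] n(1) by fastforce
  moreover have "of_nat n + (1::complex) \<noteq> 0"
    by (metis of_nat_Suc of_nat_neq_0 add.commute)
  ultimately have "\<mu> = of_nat n"
    by simp
  then have "c = of_nat n - of_nat j * 2"
    by (simp add: \<mu>_def algebra_simps)
  then show ?thesis
    by auto
qed


section \<open>Minimal subspaces and primary decomposition\<close>

text \<open>Least dimension suffices: inside the span of a finite set, a proper subspace has smaller
  dimension.\<close>

lemma minimal_subspace:
  assumes F: "finite F" "V0 \<subseteq> cspan F" and V0: "csubspace V0" "Q V0"
  obtains V where "csubspace V" "V \<subseteq> V0" "Q V"
    "\<And>U. csubspace U \<Longrightarrow> U \<subseteq> V \<Longrightarrow> Q U \<Longrightarrow> U = V"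
proof -
  define S where "S V \<longleftrightarrow> csubspace V \<and> V \<subseteq> V0 \<and> Q V" for V
  have "S V0"
    using V0 by (simp add: S_def)
  then obtain V where V: "S V" "\<And>U. S U \<Longrightarrow> cv.dim V \<le> cv.dim U"
    using ex_has_least_nat[of S V0 cv.dim] by blast
  have "U = V" if U: "csubspace U" "U \<subseteq> V" "Q U" for U
  proof (rule ccontr)
    assume "U \<noteq> V"
    then obtain v where v: "v \<in> V" "v \<notin> U"
      using U by auto
    obtain B where B: "B \<subseteq> U" "cv.independent B" "U \<subseteq> cv.span B" "card B = cv.dim U"
      using cv.basis_exists by blast
    obtain C where C: "C \<subseteq> V" "cv.independent C" "V \<subseteq> cv.span C" "card C = cv.dim V"
      using cv.basis_exists by blast
    have "finite B" "finite C"
      using cv.independent_span_bound[OF F(1)] B C V(1) U F(2) by (auto simp: S_def cspan_def)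
    have "v \<notin> cv.span B"
      using v(2) cv.span_minimal[OF B(1)] U(1) by (auto simp: csubspace_def)
    then have "cv.independent (insert v B)"
      using B(2) by (simp add: cv.independent_insert)
    moreover have "insert v B \<subseteq> cv.span C"
      using v B U C by auto
    ultimately have "card (insert v B) \<le> card C"
      using cv.independent_span_bound[OF \<open>finite C\<close>] by auto
    moreover have "v \<notin> B"
      using B(1) v(2) by auto
    ultimately have "cv.dim U < cv.dim V"
      using B C \<open>finite B\<close> by simp
    moreover have "S U"
      using U V(1) by (auto simp: S_def)
    ultimately show False
      using V(2) by fastforce
  qed
  with V(1) that show ?thesis
    by (auto simp: S_def)
qed

text \<open>For \<open>D = T - a\<close> this is the generalized eigenspace of \<open>T\<close> in
  \<open>V\<close>; the exponent may vary with the vector.\<close>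

definition nil_part :: "('v::complex_vector \<Rightarrow> 'v) \<Rightarrow> 'v set \<Rightarrow> 'v set" where
  "nil_part D V = {v \<in> V. \<exists>k. (D ^^ k) v = 0}"

lemma clin_funpow:
  assumes "clin D"
  shows "clin (D ^^ k)"
proof (induction k)
  case 0
  then show ?case
    by unfold_locales (simp_all add: scaleC_add_right scaleC_add_left scaleC_scaleC)
next
  case (Suc k)
  then show ?case
    using module_hom_compose[OF Suc assms] by (simp add: comp_def)
qed

lemma clin_shift:
  assumes "clin T"
  shows "clin (\<lambda>w. T w - a *\<^sub>C w)"
proof -
  interpret T: module_hom scaleC scaleC T by (rule assms)
  show ?thesis
    by unfold_locales (simp_all add: T.add T.scale cv.scale_right_distrib
        cv.scale_right_diff_distrib cv.scale_left_commute)
qed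

lemma csubspace_preimage:
  assumes "clin D" "csubspace U" "csubspace N"
  shows "csubspace {w \<in> U. D w \<in> N}"
proof -
  interpret D: module_hom scaleC scaleC D by (rule assms(1))
  show ?thesis
    using assms(2,3) unfolding csubspace_def cv.subspace_def by (simp add: D.zero D.add D.scale)
qed

lemma nil_part_subspace:
  assumes D: "clin D" and V: "csubspace V"
  shows "csubspace (nil_part D V)"
proof -
  have zero: "(D ^^ k) v = 0" if "(D ^^ j) v = 0" "j \<le> k" for j k v
  proof -
    have "(D ^^ k) v = (D ^^ (k - j)) ((D ^^ j) v)"
      using that(2) by (metis funpow_add comp_apply le_add_diff_inverse2)
    then show ?thesis
      using that module_hom.zero[OF clin_funpow[OF D]] by simp
  qed
  have "x + y \<in> nil_part D V" if xy: "x \<in> nil_part D V" "y \<in> nil_part D V" for x y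
  proof -
    obtain i j where "(D ^^ i) x = 0" "(D ^^ j) y = 0"
      using xy unfolding nil_part_def by blast
    then have "(D ^^ (max i j)) (x + y) = 0"
      using zero[of i x "max i j"] zero[of j y "max i j"] module_hom.add[OF clin_funpow[OF D]] by simp
    moreover have "x + y \<in> V"
      using that V by (simp add: nil_part_def csubspace_add)
    ultimately show ?thesis
      unfolding nil_part_def by blast
  qed
  moreover have "(D ^^ 0) 0 = 0"
    by simp
  then have "0 \<in> nil_part D V"
    using V unfolding nil_part_def by (blast intro: csubspace_0)
  moreover have "c *\<^sub>C x \<in> nil_part D V" if x: "x \<in> nil_part D V" for c x
  proof -
    obtain k where "(D ^^ k) x = 0"
      using x unfolding nil_part_def by blast
    then have "(D ^^ k) (c *\<^sub>C x) = 0"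
      using module_hom.scale[OF clin_funpow[OF D]] by simp
    moreover have "c *\<^sub>C x \<in> V"
      using that V by (simp add: nil_part_def csubspace_scale)
    ultimately show ?thesis
      unfolding nil_part_def by blast
  qed
  ultimately show ?thesis
    unfolding csubspace_def cv.subspace_def by blast
qed

lemma nil_part_preimage:
  assumes "v \<in> V" "D v \<in> nil_part D V"
  shows "v \<in> nil_part D V"
proof -
  obtain k where "(D ^^ k) (D v) = 0"
    using assms by (auto simp: nil_part_def)
  then have "(D ^^ Suc k) v = 0"
    by (simp add: funpow_swap1)
  with assms(1) show ?thesis
    unfolding nil_part_def by blast
qed

text \<open>Strip the roots of an annihilating polynomial. If \<open>(T - a) v\<close> lies in the
  span \<open>S\<close> of the generalized eigenspaces, it equals \<open>(T - a) w\<close> for some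
  \<open>w\<close> in \<open>S\<close>, up to a generalized eigenvector for \<open>a\<close>; then
  \<open>v - w\<close> is one too.\<close>

lemma primary_decomposition:
  assumes T: "clin T" and V: "csubspace V" "stable T V"
    and alg: "algebraic_mod T {0} v" and v: "v \<in> V"
  shows "v \<in> cspan (\<Union>a. nil_part (\<lambda>w. T w - a *\<^sub>C w) V)"
proof -
  interpret T: module_hom scaleC scaleC T by (rule T)
  define D where "D a = (\<lambda>w. T w - a *\<^sub>C w)" for a
  define S where "S = cspan (\<Union>a. nil_part (D a) V)"
  have S: "csubspace S"
    by (simp add: S_def csubspace_def cspan_def)
  have nil_S: "x \<in> S" if "x \<in> nil_part (D a) V" for x a
    using that by (auto simp: S_def cspan_def intro: cv.span_base)
  have S_V: "S \<subseteq> V"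
    using V(1) unfolding S_def cspan_def csubspace_def
    by (intro cv.span_minimal) (auto simp: nil_part_def)
  have D_V: "D a w \<in> V" if "w \<in> V" for a w
    using that V by (auto simp: D_def csubspace_diff csubspace_scale)
  have nil: "csubspace (nil_part (D a) V)" for a
    unfolding D_def by (intro nil_part_subspace clin_shift T V)
  interpret D: module_hom scaleC scaleC "D a" for a
    unfolding D_def by (rule clin_shift[OF T])
  \<comment> \<open>\<open>D a\<close> maps \<open>S\<close> onto \<open>S\<close> up to the
    generalized eigenspace of \<open>a\<close>: on that space \<open>w = 0\<close> serves, and on
    the others \<open>D a\<close> is invertible.\<close>
  have solve: "\<exists>w\<in>S. s - D a w \<in> nil_part (D a) V" if "s \<in> S" for s a
    using that[unfolded S_def cspan_def]
  proof (induction rule: cv.span_induct)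
    case base
    show ?case
      unfolding cv.subspace_def
    proof safe
      show "\<exists>w\<in>S. 0 - D a w \<in> nil_part (D a) V"
        using nil S by (intro bexI[of _ 0]) (auto simp: D.zero csubspace_0)
    next
      fix x y w z
      assume "w \<in> S" "x - D a w \<in> nil_part (D a) V" "z \<in> S" "y - D a z \<in> nil_part (D a) V"
      then show "\<exists>u\<in>S. x + y - D a u \<in> nil_part (D a) V"
        using csubspace_add[OF nil, of "x - D a w" a "y - D a z"] S
        by (intro bexI[of _ "w + z"]) (auto simp: D.add csubspace_add algebra_simps)
    next
      fix c x w
      assume "w \<in> S" "x - D a w \<in> nil_part (D a) V"
      then show "\<exists>u\<in>S. c *\<^sub>C x - D a u \<in> nil_part (D a) V"
        using csubspace_scale[OF nil, of "x - D a w" a c] S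
        by (intro bexI[of _ "c *\<^sub>C w"]) (auto simp: D.scale csubspace_scale cv.scale_right_diff_distrib)
    qed
  next
    case (step s)
    then obtain b k where "s \<in> V" "(D b ^^ k) s = 0"
      by (auto simp: nil_part_def)
    then show ?case
    proof (induction k arbitrary: s)
      case 0
      then show ?case
        using nil S by (intro bexI[of _ 0]) (auto simp: D.zero csubspace_0)
    next
      case (Suc k)
      have s: "s \<in> nil_part (D b) V"
        using Suc.prems unfolding nil_part_def by blast
      show ?case
      proof (cases "a = b")
        case True
        then show ?thesis
          using s S by (intro bexI[of _ 0]) (auto simp: D.zero csubspace_0)
      next
        case False
        obtain w where w: "w \<in> S" "D b s - D a w \<in> nil_part (D a) V"
          using Suc.IH[of "D b s"] Suc.prems D_V by (auto simp: funpow_swap1)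
        \<comment> \<open>From \<open>(b - a) s = D a s - D b s\<close> and
          \<open>D b s = D a w\<close> modulo \<open>nil_part (D a) V\<close>, one gets
          \<open>s = D a z\<close> modulo the same space.\<close>
        define z where "z = (1 / (b - a)) *\<^sub>C (s - w)"
        have "z \<in> S"
          using w s S nil_S by (auto simp: z_def intro!: csubspace_diff csubspace_scale)
        have "(b - a) *\<^sub>C s = D a s - D b s"
          by (simp add: D_def cv.scale_left_diff_distrib)
        then have "(b - a) *\<^sub>C (s - D a z) = (- 1) *\<^sub>C (D b s - D a w)"
          using False by (simp add: cv.scale_right_diff_distrib z_def D.scale D.diff)
        then have "(b - a) *\<^sub>C (s - D a z) \<in> nil_part (D a) V"
          using csubspace_scale[OF nil w(2)] by metis
        then have "s - D a z \<in> nil_part (D a) V"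
          using csubspace_scale_cancel[OF nil] False by simp
        with \<open>z \<in> S\<close> show ?thesis by blast
      qed
    qed
  qed
  obtain p where "p \<noteq> 0" "apply_poly T p v \<in> {0}"
    using alg by (auto simp: algebraic_mod_def)
  from T this have "v \<in> V \<longrightarrow> v \<in> S"
  proof (rule annihilated_induct)
    show "v \<in> V \<longrightarrow> v \<in> S" if "c \<noteq> 0" "c *\<^sub>C v \<in> {0}" for v c
      using that S by (auto simp: csubspace_0)
  next
    fix v a
    assume step: "T v - a *\<^sub>C v \<in> V \<longrightarrow> T v - a *\<^sub>C v \<in> S"
    show "v \<in> V \<longrightarrow> v \<in> S"
    proof
      assume "v \<in> V"
      then have "D a v \<in> S"
        using step D_V by (simp add: D_def)
      then obtain w where w: "w \<in> S" "D a v - D a w \<in> nil_part (D a) V"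
        using solve by blast
      have "v - w \<in> nil_part (D a) V"
      proof (rule nil_part_preimage)
        show "v - w \<in> V"
          using \<open>v \<in> V\<close> w(1) S_V V(1) by (auto intro: csubspace_diff)
        show "D a (v - w) \<in> nil_part (D a) V"
          using w(2) by (simp add: D.diff)
      qed
      then have "v - w + w \<in> S"
        by (rule csubspace_add[OF S nil_S w(1)])
      then show "v \<in> S"
        by simp
    qed
  qed
  with v show ?thesis
    by (simp add: S_def D_def)
qed


section \<open>Modules over nilpotent Lie algebras\<close>

context
  fixes br :: "'a::complex_vector \<Rightarrow> 'a \<Rightarrow> 'a" and act :: "'a \<Rightarrow> 'm::complex_vector \<Rightarrow> 'm"
  assumes module: "lie_module br act"
begin

lemma act_clin: "clin (act x)"
  using module unfolding lie_module_def
  by unfold_locales (auto simp: scaleC_add_right scaleC_add_left scaleC_scaleC)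

lemma act_bracket: "act (br x y) m = act x (act y m) - act y (act x m)"
  using module by (simp add: lie_module_def)

lemma act_zero: "act 0 m = 0"
proof -
  have "act (0 *\<^sub>C 0) m = 0 *\<^sub>C act 0 m"
    using module unfolding lie_module_def by blast
  then show ?thesis by simp
qed

end

context
  fixes br :: "'a::complex_vector \<Rightarrow> 'a \<Rightarrow> 'a" and H :: "'a set"
  assumes H: "lie_subalg br H" and nilp: "nilpotent br H"
begin

text \<open>Climb the lower central series from its vanishing term: bracketing one term with
  \<open>H\<close> lands in the next, where \<open>Q\<close> is already known.\<close>

lemma nilpotent_induct [consumes 1, case_names zero step]:
  assumes "b \<in> H" and zero: "Q 0"
    and step: "\<And>b. b \<in> H \<Longrightarrow> (\<And>a. a \<in> H \<Longrightarrow> Q (br a b)) \<Longrightarrow> Q b"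
  shows "Q b"
proof -
  obtain k where k: "lower_central_series br H k \<subseteq> {0}"
    using nilp by (auto simp: nilpotent_def)
  have sub: "lower_central_series br H j \<subseteq> H" for j
  proof (induction j)
    case (Suc j)
    then have "{br x y |x y. x \<in> H \<and> y \<in> lower_central_series br H j} \<subseteq> H"
      using H by (auto simp: lie_subalg_def)
    then show ?case
      using H cv.span_minimal[of _ H] unfolding lie_subalg_def csubspace_def
      by (simp add: bracket_set_def cspan_def)
  qed auto
  have "\<forall>b\<in>lower_central_series br H 0. Q b"
  proof (rule inc_induct[of 0 k])
    show "\<forall>b\<in>lower_central_series br H k. Q b"
      using k zero by auto
  next
    fix n
    assume IH: "\<forall>b\<in>lower_central_series br H (Suc n). Q b"
    have "br a b \<in> lower_central_series br H (Suc n)"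
      if "a \<in> H" "b \<in> lower_central_series br H n" for a b
      using that by (auto simp: bracket_set_def cspan_def intro!: cv.span_base)
    then show "\<forall>b\<in>lower_central_series br H n. Q b"
      using IH sub by (blast intro: step)
  qed simp
  with \<open>b \<in> H\<close> show ?thesis
    by simp
qed

context
  fixes act :: "'a \<Rightarrow> 'm::complex_vector \<Rightarrow> 'm"
  assumes module: "lie_module br act"
begin

text \<open>With \<open>D = a - c\<close> one has \<open>D (b v) = [a, b] v + b (D v)\<close>. The
  induction over \<open>H\<close> covers \<open>[a, b]\<close>, an inner one on the exponent killing
  \<open>v\<close> covers \<open>D v\<close>.\<close>

lemma nil_part_stable:
  assumes a: "a \<in> H" and V: "csubspace V" "\<And>h. h \<in> H \<Longrightarrow> stable (act h) V" and "b \<in> H"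
  shows "stable (act b) (nil_part (\<lambda>w. act a w - c *\<^sub>C w) V)"
proof -
  define D where "D = (\<lambda>w. act a w - c *\<^sub>C w)"
  have D: "clin D"
    unfolding D_def by (intro clin_shift act_clin[OF module])
  have nil: "csubspace (nil_part D V)"
    by (intro nil_part_subspace D V)
  interpret act: module_hom scaleC scaleC "act x" for x
    by (rule act_clin[OF module])
  from \<open>b \<in> H\<close> have "stable (act b) (nil_part D V)"
  proof (induction rule: nilpotent_induct)
    case zero
    show ?case
      using nil by (simp add: act_zero[OF module] csubspace_0)
  next
    case (step b)
    have "act b v \<in> nil_part D V" if "v \<in> V" "(D ^^ k) v = 0" for v k
      using that
    proof (induction k arbitrary: v)
      case 0
      then show ?case
        using nil by (simp add: act.zero csubspace_0)
    next
      case (Suc k)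
      have "D v \<in> V"
        using Suc.prems a V by (auto simp: D_def intro!: csubspace_diff csubspace_scale)
      then have "act b (D v) \<in> nil_part D V"
        using Suc by (simp add: funpow_swap1)
      moreover have "v \<in> nil_part D V"
        using Suc.prems unfolding nil_part_def by blast
      then have "act (br a b) v \<in> nil_part D V"
        using step a by blast
      ultimately have "act (br a b) v + act b (D v) \<in> nil_part D V"
        by (intro csubspace_add nil)
      also have "act (br a b) v + act b (D v) = D (act b v)"
        by (simp add: D_def act_bracket[OF module] act.diff act.scale)
      finally show ?case
        using Suc.prems V step by (auto intro: nil_part_preimage)
    qed
    then show ?case
      by (auto simp: nil_part_def)
  qed
  then show ?thesis
    by (simp add: D_def)
qed

lemma finite_dim_algebraic:
  assumes "finite F" "csubspace N" "V \<subseteq> cspan F" "stable (act h) V" "v \<in> V"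
  shows "algebraic_mod (act h) N v"
proof -
  have "(act h ^^ k) v \<in> set_plus_c (cspan F) N" for k
  proof -
    have "(act h ^^ k) v \<in> cspan F"
      using funpow_mem[OF act_clin[OF module] assms(4,5)] assms(3) by blast
    moreover have "(act h ^^ k) v = (act h ^^ k) v + 0"
      by simp
    ultimately show ?thesis
      using csubspace_0[OF assms(2)] unfolding set_plus_c_def by blast
  qed
  then show ?thesis
    using annihilator_exists[OF act_clin[OF module] assms(1,2)] unfolding algebraic_mod_def by metis
qed

text \<open>In a minimal stable subspace, the successive terms of the lower central series act by scalars,
  from the last one upwards: scalars that are commutators vanish, so the next term acts by
  intertwiners, and Schur's lemma applies.\<close>
lemma minimal_stable_scalar:
  assumes F: "finite F" "W \<subseteq> cspan F"
    and W: "csubspace W" "\<And>h. h \<in> H \<Longrightarrow> stable (act h) W" "W \<noteq> {0}"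
    and min: "\<And>U. csubspace U \<Longrightarrow> U \<subseteq> W \<Longrightarrow> (\<And>h. h \<in> H \<Longrightarrow> stable (act h) U) \<Longrightarrow> U \<noteq> {0} \<Longrightarrow> U = W"
    and "b \<in> H"
  shows "\<exists>c. \<forall>w\<in>W. act b w = c *\<^sub>C w"
proof -
  interpret act: module_hom scaleC scaleC "act x" for x
    by (rule act_clin[OF module])
  have zero_space: "csubspace {0::'m}"
    by (simp add: csubspace_def)
  have alg: "algebraic_mod (act h) {0} w" if "h \<in> H" "w \<in> W" for h w
    using finite_dim_algebraic[OF F(1) zero_space F(2) W(2)] that by blast
  obtain w0 where w0: "w0 \<in> W" "w0 \<notin> {0}"
    using W csubspace_0 by blast
  from \<open>b \<in> H\<close> show ?thesis
  proof (induction rule: nilpotent_induct)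
    case zero
    show ?case
      by (intro exI[of _ 0]) (simp add: act_zero[OF module])
  next
    case (step b)
    have comm: "act a (act b w) = act b (act a w)" if a: "a \<in> H" and w: "w \<in> W" for a w
    proof -
      obtain c where c: "\<And>w. w \<in> W \<Longrightarrow> act a (act b w) - act b (act a w) = c *\<^sub>C w"
        using step.IH[OF a] by (auto simp: act_bracket[OF module])
      \<comment> \<open>The Heisenberg lemma with \<open>N = {0}\<close> replaces the usual trace
        argument.\<close>
      have "c = 0"
      proof (rule ccontr)
        assume "c \<noteq> 0"
        show False
          by (rule heisenberg_contradiction[OF act_clin[OF module] act_clin[OF module] zero_space _ _ W(1) W(2) W(2) w0
                alg alg _ \<open>c \<noteq> 0\<close>, of a b])
            (use a step.hyps w0 c in \<open>auto simp: act.zero\<close>)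
      qed
      with c[OF w] show ?thesis
        by simp
    qed
    obtain p where "p \<noteq> 0" "apply_poly (act b) p w0 \<in> {0}"
      using alg[OF step.hyps w0(1)] by (auto simp: algebraic_mod_def)
    from eigenvector_mod[OF act_clin[OF module] zero_space W(1) W(2)[OF step.hyps] w0 this]
    obtain u c where u: "u \<in> W" "u \<noteq> 0" "act b u = c *\<^sub>C u"
      by auto
    define U where "U = {w \<in> W. act b w = c *\<^sub>C w}"
    have "U = W"
    proof (rule min)
      show "csubspace U"
        using W(1) unfolding csubspace_def U_def
        by (auto simp: cv.subspace_def act.zero act.add act.scale scaleC_add_right cv.scale_left_commute)
      show "U \<subseteq> W" "U \<noteq> {0}"
        using u by (auto simp: U_def)
      show "stable (act h) U" if "h \<in> H" for h
        using that W(2)[OF that] comm[OF that] by (auto simp: U_def act.scale simp flip: comm)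
    qed
    then show ?case
      unfolding U_def by blast
  qed
qed

text \<open>A common eigenvector in \<open>V0\<close> may lie in \<open>N\<close>, so its weight
  need not obviously occur modulo \<open>N\<close>. On a minimal stable \<open>V\<close> not inside
  \<open>N\<close>, each element of \<open>H\<close> has a single generalized eigenvalue, which
  links the two. The vector \<open>u\<close> may depend on \<open>a\<close>.\<close>

lemma nilpotent_weight:
  assumes F: "finite F" "V0 \<subseteq> cspan F"
    and V0: "csubspace V0" "\<And>h. h \<in> H \<Longrightarrow> stable (act h) V0" "\<not> V0 \<subseteq> N"
    and N: "csubspace N"
  obtains \<eta> where "\<eta> \<in> weight_support act H"
    "\<And>a. a \<in> H \<Longrightarrow> \<exists>u\<in>V0. u \<notin> N \<and> act a u - \<eta> a *\<^sub>C u \<in> N"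
proof -
  have zero_space: "csubspace {0::'m}"
    by (simp add: csubspace_def)
  text \<open>Minimality makes every generalized eigenspace in \<open>V\<close> either all of \<open>V\<close> or contained in \<open>N\<close>.\<close>
  let ?Q = "\<lambda>V. (\<forall>h\<in>H. stable (act h) V) \<and> \<not> V \<subseteq> N"
  have "?Q V0"
    using V0 by blast
  then obtain V where V: "csubspace V" "V \<subseteq> V0" "?Q V"
    and V_min: "\<And>U. csubspace U \<Longrightarrow> U \<subseteq> V \<Longrightarrow> ?Q U \<Longrightarrow> U = V"
    using minimal_subspace[OF F V0(1), of ?Q] by blast
  have V_stable: "stable (act h) V" if "h \<in> H" for h
    using V that by blast
  have V_F: "V \<subseteq> cspan F"
    using V F by blast
  have single: "\<exists>c. nil_part (\<lambda>w. act a w - c *\<^sub>C w) V = V" if a: "a \<in> H" for a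
  proof (rule ccontr)
    assume *: "\<not> ?thesis"
    have "nil_part (\<lambda>w. act a w - c *\<^sub>C w) V \<subseteq> N" for c
    proof (rule ccontr)
      assume "\<not> nil_part (\<lambda>w. act a w - c *\<^sub>C w) V \<subseteq> N"
      moreover have "nil_part (\<lambda>w. act a w - c *\<^sub>C w) V \<subseteq> V"
        by (auto simp: nil_part_def)
      ultimately have "nil_part (\<lambda>w. act a w - c *\<^sub>C w) V = V"
        using nil_part_stable[OF a V(1) V_stable]
        by (intro V_min nil_part_subspace clin_shift act_clin[OF module] V(1)) blast+
      with * show False by blast
    qed
    then have "cspan (\<Union>c. nil_part (\<lambda>w. act a w - c *\<^sub>C w) V) \<subseteq> N"
      using N unfolding cspan_def csubspace_def by (intro cv.span_minimal) auto
    moreover have "V \<subseteq> cspan (\<Union>c. nil_part (\<lambda>w. act a w - c *\<^sub>C w) V)"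
      using primary_decomposition[OF act_clin[OF module] V(1) V_stable[OF a]]
        finite_dim_algebraic[OF F(1) zero_space V_F V_stable[OF a]] by blast
    ultimately show False
      using V(3) by blast
  qed
  \<comment> \<open>\<open>W\<close> may lie inside \<open>N\<close>; it supplies a common
    eigenvector in the module itself, which puts \<eta> into the support.\<close>
  let ?R = "\<lambda>W. (\<forall>h\<in>H. stable (act h) W) \<and> W \<noteq> {0}"
  have "?R V"
    using V csubspace_0[OF N] by blast
  then obtain W where W: "csubspace W" "W \<subseteq> V" "?R W"
    and W_min: "\<And>U. csubspace U \<Longrightarrow> U \<subseteq> W \<Longrightarrow> ?R U \<Longrightarrow> U = W"
    using minimal_subspace[OF F(1) V_F V(1), of ?R] by blast
  have W_stable: "stable (act h) W" if "h \<in> H" for h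
    using W that by blast
  have "\<exists>c. \<forall>w\<in>W. act b w = c *\<^sub>C w" if "b \<in> H" for b
  proof (rule minimal_stable_scalar[OF F(1) _ W(1)])
    show "W \<subseteq> cspan F"
      using W V_F by blast
    show "W \<noteq> {0}"
      using W by blast
  qed (use W_stable W_min that in blast)+
  then obtain \<eta> where \<eta>: "\<And>b w. b \<in> H \<Longrightarrow> w \<in> W \<Longrightarrow> act b w = \<eta> b *\<^sub>C w"
    by metis
  obtain w where w: "w \<in> W" "w \<noteq> 0"
    using W csubspace_0[OF W(1)] by blast
  show ?thesis
  proof
    show "\<eta> \<in> weight_support act H"
      using w \<eta> by (auto simp: weight_support_def)
    fix a
    assume a: "a \<in> H"
    obtain c where c: "nil_part (\<lambda>w. act a w - c *\<^sub>C w) V = V"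
      using single[OF a] by blast
    define D where "D = (\<lambda>w. act a w - c *\<^sub>C w)"
    have D: "v \<in> V \<Longrightarrow> \<exists>k. (D ^^ k) v = 0" for v
      using c unfolding nil_part_def D_def by blast
    have "(D ^^ k) w = (\<eta> a - c) ^ k *\<^sub>C w" for k
    proof (induction k)
      case (Suc k)
      have "D ((\<eta> a - c) ^ k *\<^sub>C w) = (\<eta> a - c) *\<^sub>C (\<eta> a - c) ^ k *\<^sub>C w"
        using \<eta>[OF a csubspace_scale[OF W(1) w(1)]] by (simp add: D_def algebra_simps flip: cv.scale_left_diff_distrib)
      with Suc show ?case
        by simp
    qed simp
    moreover obtain k where "(D ^^ k) w = 0"
      using D w W by blast
    ultimately have "\<eta> a = c"
      using w by simp
    obtain v where v: "v \<in> V" "v \<notin> N"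
      using V by blast
    then obtain k where "(D ^^ k) v \<in> N"
      using D csubspace_0[OF N] by metis
    then obtain j where j: "(D ^^ j) v \<notin> N" "D ((D ^^ j) v) \<in> N"
      using v(2) last_outside by metis
    have "stable D V"
      using V_stable[OF a] V(1) by (auto simp: D_def csubspace_diff csubspace_scale)
    then have "(D ^^ j) v \<in> V"
      using v(1) unfolding D_def by (intro funpow_mem clin_shift act_clin[OF module]) auto
    with j V(2) \<open>\<eta> a = c\<close> show "\<exists>u\<in>V0. u \<notin> N \<and> act a u - \<eta> a *\<^sub>C u \<in> N"
      by (auto simp: D_def)
  qed
qed

end

end

section \<open>Proportionality of bilinear forms\<close>

text \<open>Pairs containing \<open>x0\<close> or \<open>y0\<close> come first: a multiple of the
  other base vector makes \<open>A\<close> vanish, hence \<open>B\<close>. The general pair is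
  reduced to these. The value 2 is that of a root on its coroot.\<close>

lemma forms_proportional:
  fixes A B :: "'x::complex_vector \<Rightarrow> 'y::complex_vector \<Rightarrow> complex"
  assumes X: "csubspace X" and Y: "csubspace Y"
    and left: "\<And>x x' y s. x \<in> X \<Longrightarrow> x' \<in> X \<Longrightarrow> y \<in> Y \<Longrightarrow>
        A (x + s *\<^sub>C x') y = A x y + s * A x' y \<and> B (x + s *\<^sub>C x') y = B x y + s * B x' y"
    and right: "\<And>x y y' s. x \<in> X \<Longrightarrow> y \<in> Y \<Longrightarrow> y' \<in> Y \<Longrightarrow>
        A x (y + s *\<^sub>C y') = A x y + s * A x y' \<and> B x (y + s *\<^sub>C y') = B x y + s * B x y'"
    and null: "\<And>x y. x \<in> X \<Longrightarrow> y \<in> Y \<Longrightarrow> A x y = 0 \<Longrightarrow> B x y = 0"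
    and base: "x0 \<in> X" "y0 \<in> Y" "A x0 y0 = 2"
    and xy: "x \<in> X" "y \<in> Y"
  shows "B x y = B x0 y0 / 2 * A x y"
proof -
  define c where "c = B x0 y0 / 2"
  have x0: "B x0 y = c * A x0 y" if "y \<in> Y" for y
  proof -
    define s where "s = - A x0 y / 2"
    have "y + s *\<^sub>C y0 \<in> Y"
      using that base Y by (simp add: csubspace_add csubspace_scale)
    then have "B x0 y + s * B x0 y0 = 0"
      using null[OF base(1), of "y + s *\<^sub>C y0"] right[OF base(1) that base(2), of s] base(3)
      by (auto simp: s_def simp del: cv.scale_minus_left)
    then show ?thesis
      by (simp add: s_def c_def field_simps)
  qed
  have y0: "B x y0 = c * A x y0" if "x \<in> X" for x
  proof -
    define s where "s = - A x y0 / 2"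
    have "x + s *\<^sub>C x0 \<in> X"
      using that base X by (simp add: csubspace_add csubspace_scale)
    then have "B x y0 + s * B x0 y0 = 0"
      using null[OF _ base(2), of "x + s *\<^sub>C x0"] left[OF that base(1,2), of s] base(3)
      by (auto simp: s_def simp del: cv.scale_minus_left)
    then show ?thesis
      by (simp add: s_def c_def field_simps)
  qed
  text \<open>Move \<open>(x, y)\<close> along \<open>x0\<close> and \<open>y0\<close> to a point where \<open>A\<close> vanishes; this does not change
    \<open>B - c A\<close>.\<close>
  define r where "r = (1 - A x0 y) / 2"
  define s where "s = - (A x y + r * A x y0)"
  define y' where "y' = y + r *\<^sub>C y0"
  have y': "y' \<in> Y"
    using xy base Y by (auto simp: y'_def csubspace_add csubspace_scale)
  \<comment> \<open>The choice of \<open>r\<close> makes \<open>A x0 y'\<close> equal to 1 whatever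
    \<open>A x0 y\<close> is, so that \<open>s\<close> can cancel \<open>A x y'\<close>.\<close>
  have A: "A x y' = A x y + r * A x y0" "A x0 y' = 1"
    using right xy base by (auto simp: y'_def r_def field_simps)
  have B: "B x y' = B x y + r * (c * A x y0)"
    using right[OF xy base(2), of r] y0[OF xy(1)] by (simp add: y'_def)
  have "A (x + s *\<^sub>C x0) y' = 0"
    using left[OF xy(1) base(1) y', of s] A by (simp add: s_def)
  then have "B (x + s *\<^sub>C x0) y' = 0"
    using null xy base X y' by (auto simp: csubspace_add csubspace_scale)
  then have "B x y + r * (c * A x y0) + s * c = 0"
    using left[OF xy(1) base(1) y', of s] A B x0[OF y'] by simp
  then show ?thesis
    by (simp add: s_def c_def[symmetric] algebra_simps)
qed


section \<open>Roots, weights and integrality on coroots\<close>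

text \<open>Roots and weights are encoded as arbitrary functions; a nonzero simultaneous eigenvector
  forces linearity on \<open>K\<close>.\<close>

lemma eigenvalue_linear:
  assumes K: "csubspace K" and g: "\<And>x y. g (x + y) = g x + g y" "\<And>c x. g (c *\<^sub>C x) = c *\<^sub>C g x"
    and m: "m \<noteq> 0" "\<And>h. h \<in> K \<Longrightarrow> g h = f h *\<^sub>C m"
  shows eigenvalue_add: "x \<in> K \<Longrightarrow> y \<in> K \<Longrightarrow> f (x + y) = f x + f y"
    and eigenvalue_scale: "x \<in> K \<Longrightarrow> f (c *\<^sub>C x) = c * f x"
proof -
  assume x: "x \<in> K"
  then have "g x = f x *\<^sub>C m" "g (c *\<^sub>C x) = f (c *\<^sub>C x) *\<^sub>C m"
    using m(2) K by (auto simp only: csubspace_scale)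
  then have "f (c *\<^sub>C x) *\<^sub>C m = (c * f x) *\<^sub>C m"
    using g(2)[of c x] by (simp only: scaleC_scaleC)
  with m(1) show "f (c *\<^sub>C x) = c * f x"
    by (simp only: cv.scale_cancel_right) simp
  assume y: "y \<in> K"
  have "f (x + y) *\<^sub>C m = (f x + f y) *\<^sub>C m"
    using m(2)[OF x] m(2)[OF y] m(2)[of "x + y"] g(1)[of x y] K x y
    by (simp add: csubspace_add scaleC_add_left)
  with m(1) show "f (x + y) = f x + f y"
    by (simp only: cv.scale_cancel_right) simp
qed

text \<open>\<open>cspan F\<close> is stable only modulo \<open>N2\<close>; as \<open>N2\<close> is
  a submodule, all iterates of \<open>w\<close> stay in \<open>cspan F + N2\<close>.\<close>

lemma fk_algebraic:
  assumes module: "lie_module br act" and N2: "submodule act N2"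
    and x: "x \<in> fk_subalg_subquot act N1 N2" and w: "w \<in> N1"
  shows "algebraic_mod (act x) N2 w"
proof -
  have N: "csubspace N2" "stable (act x) N2"
    using N2 by (auto simp: submodule_def)
  obtain F where F: "finite F" "w \<in> set_plus_c (cspan F) N2"
    and act_F: "\<And>v. v \<in> cspan F \<Longrightarrow> act x v \<in> set_plus_c (cspan F) N2"
    using x w unfolding fk_subalg_subquot_def by blast
  have "(act x ^^ k) w \<in> set_plus_c (cspan F) N2" for k
  proof (induction k)
    case 0
    then show ?case
      using F by simp
  next
    case (Suc k)
    then obtain f n where fn: "(act x ^^ k) w = f + n" "f \<in> cspan F" "n \<in> N2"
      by (auto simp: set_plus_c_def)
    obtain f' n' where fn': "act x f = f' + n'" "f' \<in> cspan F" "n' \<in> N2"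
      using act_F[OF fn(2)] by (auto simp: set_plus_c_def)
    have "(act x ^^ Suc k) w = f' + (n' + act x n)"
      using module fn(1) fn'(1) by (simp add: lie_module_def add.assoc)
    moreover have "n' + act x n \<in> N2"
      using N fn fn' by (simp add: csubspace_add)
    ultimately show ?case
      using fn'(2) by (auto simp: set_plus_c_def)
  qed
  then show ?thesis
    using annihilator_exists[OF act_clin[OF module] F(1) N(1)] unfolding algebraic_mod_def by metis
qed

lemma cspan_induct_subspace:
  assumes "h \<in> cspan S" "csubspace {h. Q h}" "\<And>h. h \<in> S \<Longrightarrow> Q h"
  shows "Q h"
  by (rule cv.span_induct[OF assms[unfolded cspan_def csubspace_def]])

theorem theorem1:
  fixes br :: "'a::complex_vector \<Rightarrow> 'a \<Rightarrow> 'a"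
    and act :: "'a \<Rightarrow> 'm::complex_vector \<Rightarrow> 'm"
    and L H P N1 N2
  assumes "lie_algebra br"
    and "fin_dim (UNIV :: 'a set)"
    and "semisimple br UNIV"
    and "reductive br L"
    and "cartan_subalg br UNIV H"
    and "cartan_subalg br L (H \<inter> L)"
    and "parabolic_subalg br UNIV P"
    and "H \<subseteq> P"
    and "parabolic_subalg br L (P \<inter> L)"
    and "lie_module br act"
    and "acts_locally_finitely act P"
    and "submodule act N1" and "submodule act N2" and "N2 \<subseteq> N1" and "N1 \<noteq> N2"
    and "\<forall>\<eta> \<in> weight_support act H. \<not> integral_rel br L (H \<inter> L) \<eta>"
  shows "\<not> L \<subseteq> fk_subalg_subquot act N1 N2"
proof
  assume fk: "L \<subseteq> fk_subalg_subquot act N1 N2"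
  note module = \<open>lie_module br act\<close>
  interpret act: module_hom scaleC scaleC "act x" for x
    by (rule act_clin[OF module])
  have N1: "csubspace N1" "\<And>x. stable (act x) N1" and N2: "csubspace N2" "\<And>x. stable (act x) N2"
    using assms(12,13) by (auto simp: submodule_def)
  have H: "lie_subalg br H" "nilpotent br H"
    using assms(5) by (auto simp: cartan_subalg_def)
  obtain m where m: "m \<in> N1" "m \<notin> N2"
    using assms(14,15) by blast
  have "\<exists>F. finite F \<and> m \<in> cspan F \<and> (\<forall>x\<in>P. stable (act x) (cspan F))"
    using assms(11) unfolding acts_locally_finitely_def by (rule spec)
  then obtain F where F: "finite F" "m \<in> cspan F"
    and F_stable: "\<And>x. x \<in> P \<Longrightarrow> stable (act x) (cspan F)"
    by metis
  \<comment> \<open>As \<open>H\<close> lies in \<open>P\<close>, this intersection is a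
    finite-dimensional \<open>H\<close>-stable subspace of \<open>N1\<close>; it contains
    \<open>m\<close>, which is not in \<open>N2\<close>.\<close>
  have V: "csubspace (cspan F \<inter> N1)"
    using N1(1) by (simp add: csubspace_def cspan_def cv.subspace_inter)
  have V_stable: "stable (act h) (cspan F \<inter> N1)" if "h \<in> H" for h
    using F_stable[of h] N1(2) that assms(8) by blast
  have "\<not> cspan F \<inter> N1 \<subseteq> N2"
    using m F(2) by blast
  from nilpotent_weight[OF H module F(1) Int_lower1 V V_stable this N2(1)] obtain \<eta> where \<eta>: "\<eta> \<in> weight_support act H"
    and eigen: "\<And>a. a \<in> H \<Longrightarrow> \<exists>u\<in>cspan F \<inter> N1. u \<notin> N2 \<and> act a u - \<eta> a *\<^sub>C u \<in> N2"
    by blast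
  define K where "K = H \<inter> L"
  obtain \<alpha> hc where \<alpha>: "is_root br L K \<alpha>" "is_coroot br L K \<alpha> hc" and not_int: "\<eta> hc \<notin> \<int>"
    using assms(16) \<eta> unfolding integral_rel_def K_def by blast
  define X where "X = root_space br L K \<alpha>"
  define Y where "Y = root_space br L K (\<lambda>h. - \<alpha> h)"
  have hc: "hc \<in> cspan {br x y | x y. x \<in> X \<and> y \<in> Y}" "\<alpha> hc = 2"
    using \<alpha>(2) by (auto simp: is_coroot_def X_def Y_def bracket_set_def)
  have K: "csubspace K" "normalizer br L K = K"
    using assms(6) by (auto simp: cartan_subalg_def lie_subalg_def K_def)
  have L: "csubspace L" "\<And>x y. x \<in> L \<Longrightarrow> y \<in> L \<Longrightarrow> br x y \<in> L"
    using assms(4) by (auto simp: reductive_def lie_subalg_def)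
  have br: "br (x + y) z = br x z + br y z" "br x (y + z) = br x y + br x z"
    "br (c *\<^sub>C x) y = c *\<^sub>C br x y" "br x (c *\<^sub>C y) = c *\<^sub>C br x y" "br x x = 0"
    "br x (br y z) + br y (br z x) + br z (br x y) = 0" for x y z c
    using assms(1) by (simp_all add: lie_algebra_def)
  have br_0: "br x 0 = 0" for x
    using br(4)[of x 0 0] by simp
  have anti: "br x y = - br y x" for x y
  proof -
    have "br x y + br y x = br (x + y) (x + y)"
      by (simp only: br(1,2)) (simp add: br(5))
    also have "\<dots> = 0"
      by (rule br(5))
    finally show ?thesis
      by (simp only: eq_neg_iff_add_eq_0)
  qed
  have root_space: "csubspace (root_space br L K f)" for f
    using L(1) unfolding csubspace_def root_space_def cv.subspace_def
    by (auto simp: br br_0 scaleC_add_right cv.scale_left_commute)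
  have X: "csubspace X" and Y: "csubspace Y"
    by (simp_all add: X_def Y_def root_space)
  have act_X: "x \<in> L" "\<And>t. t \<in> K \<Longrightarrow> br t x = \<alpha> t *\<^sub>C x" if "x \<in> X" for x
    using that by (auto simp: X_def root_space_def)
  have act_Y: "y \<in> L" "\<And>t. t \<in> K \<Longrightarrow> br t y = (- \<alpha> t) *\<^sub>C y" if "y \<in> Y" for y
    using that by (auto simp: Y_def root_space_def)
  have bracket_K: "br x y \<in> K" if "x \<in> X" "y \<in> Y" for x y
  proof -
    \<comment> \<open>By the Jacobi identity the weights \<alpha> and -\<alpha> cancel, so
      \<open>br x y\<close> even centralizes \<open>K\<close>.\<close>
    have "br (br x y) h = 0" if "h \<in> K" for h
    proof -
      have "br x (br y h) = \<alpha> h *\<^sub>C br x y"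
        using act_Y(2)[OF \<open>y \<in> Y\<close> that] anti[of y h] br(4)[of x "\<alpha> h" y] by simp
      moreover have "br y (br h x) = - (\<alpha> h *\<^sub>C br x y)"
        using act_X(2)[OF \<open>x \<in> X\<close> that] br(4)[of y "\<alpha> h" x] anti[of y x] by simp
      ultimately have "br h (br x y) = 0"
        using br(6)[of x y h] by simp
      then show ?thesis
        using anti[of "br x y" h] by simp
    qed
    then have "br x y \<in> normalizer br L K"
      using L(2) act_X(1)[OF that(1)] act_Y(1)[OF that(2)] csubspace_0[OF K(1)]
      by (auto simp: normalizer_def)
    with K(2) show ?thesis
      by simp
  qed
  obtain x1 where x1: "x1 \<in> X" "x1 \<noteq> 0"
    using \<alpha>(1) by (auto simp: is_root_def X_def)
  have \<alpha>_lin: "\<And>s t. s \<in> K \<Longrightarrow> t \<in> K \<Longrightarrow> \<alpha> (s + t) = \<alpha> s + \<alpha> t"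
    "\<And>c s. s \<in> K \<Longrightarrow> \<alpha> (c *\<^sub>C s) = c * \<alpha> s"
    using eigenvalue_linear[of K "\<lambda>h. br h x1" x1 \<alpha>] K(1) br x1 act_X by auto
  obtain m0 where m0: "m0 \<noteq> 0" "\<And>h. h \<in> K \<Longrightarrow> act h m0 = \<eta> h *\<^sub>C m0"
    using \<eta> by (auto simp: weight_support_def K_def)
  have \<eta>_lin: "\<And>s t. s \<in> K \<Longrightarrow> t \<in> K \<Longrightarrow> \<eta> (s + t) = \<eta> s + \<eta> t"
    "\<And>c s. s \<in> K \<Longrightarrow> \<eta> (c *\<^sub>C s) = c * \<eta> s"
    using eigenvalue_linear[of K "\<lambda>h. act h m0" m0 \<eta>] K(1) module m0
    by (auto simp: lie_module_def)
  note comm = act_bracket[OF module, symmetric]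
  have act_scale: "act (c *\<^sub>C x) v = c *\<^sub>C act x v" for c x v
    using module by (simp add: lie_module_def)
  have alg: "algebraic_mod (act x) N2 w" if "x \<in> L" "w \<in> N1" for x w
    using fk_algebraic[OF module assms(13)] fk that by blast
  have null: "\<eta> (br x y) = 0" if xy: "x \<in> X" "y \<in> Y" and "\<alpha> (br x y) = 0" for x y
  proof (rule ccontr)
    define t where "t = br x y"
    assume "\<eta> (br x y) \<noteq> 0"
    then have "\<eta> t \<noteq> 0"
      by (simp add: t_def)
    have t: "t \<in> K" "br t x = 0" "br t y = 0"
      using bracket_K[OF xy] act_X(2)[OF xy(1)] act_Y(2)[OF xy(2)] that(3) by (auto simp: t_def)
    \<comment> \<open>On this eigenspace of \<open>t\<close> modulo \<open>N2\<close>, the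
      commutator of \<open>x\<close> and \<open>y\<close> acts as the scalar
      \<open>\<eta> t\<close>; both preserve \<open>U\<close> because they commute with
      \<open>t\<close>.\<close>
    define U where "U = {w \<in> N1. act t w - \<eta> t *\<^sub>C w \<in> N2}"
    have U: "csubspace U"
      unfolding U_def by (intro csubspace_preimage clin_shift act_clin[OF module] N1 N2)
    have U_stable: "stable (act z) U" if z: "br t z = 0" for z
    proof
      fix w
      assume w: "w \<in> U"
      have "act t (act z w) = act z (act t w)"
        using comm[of t z w] z by (simp add: act_zero[OF module])
      then have "act t (act z w) - \<eta> t *\<^sub>C act z w = act z (act t w - \<eta> t *\<^sub>C w)"
        by (simp add: act.diff act.scale)
      with w N1 N2 show "act z w \<in> U"
        by (auto simp: U_def)
    qed
    obtain u where u: "u \<in> U" "u \<notin> N2"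
      using eigen t(1) by (auto simp: K_def U_def)
    have "U \<subseteq> N1"
      by (auto simp: U_def)
    show False
      by (rule heisenberg_contradiction[OF act_clin[OF module] act_clin[OF module] N2(1) N2(2) N2(2)
            U U_stable[OF t(2)] U_stable[OF t(3)] u _ _ _ \<open>\<eta> t \<noteq> 0\<close>])
        (use alg act_X(1)[OF xy(1)] act_Y(1)[OF xy(2)] u \<open>U \<subseteq> N1\<close> in \<open>auto simp: comm t_def U_def\<close>)
  qed
  have integral: "\<eta> (br x y) \<in> \<int>" if xy: "x \<in> X" "y \<in> Y" and "\<alpha> (br x y) = 2" for x y
  proof -
    define t where "t = br x y"
    have t: "t \<in> K" "br t x = 2 *\<^sub>C x" "br t y = (- 2) *\<^sub>C y"
      using bracket_K[OF xy] act_X(2)[OF xy(1)] act_Y(2)[OF xy(2)] that(3) by (auto simp: t_def)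
    obtain u where u: "u \<in> N1" "u \<notin> N2" "act t u - \<eta> t *\<^sub>C u \<in> N2"
      using eigen t(1) by (auto simp: K_def)
    have "act x (act y w) - act y (act x w) = act t w"
      "act t (act x w) - act x (act t w) = 2 *\<^sub>C act x w"
      "act t (act y w) - act y (act t w) = (- 2) *\<^sub>C act y w" for w
      by (simp_all only: comm t act_scale flip: t_def)
    from sl2_eigenvalue_integral[OF act_clin[OF module] act_clin[OF module] act_clin[OF module]
        N2(1) N2(2) N2(2) N2(2) N1(2) N1(2) this _ _ u]
    have "\<eta> t \<in> \<int>"
      using alg act_X(1)[OF xy(1)] act_Y(1)[OF xy(2)] by blast
    then show ?thesis
      by (simp add: t_def)
  qed
  \<comment> \<open>A relation \<open>f = c \<alpha>\<close> cuts out a subspace of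
    \<open>K\<close>, so it passes from single brackets to their span, which contains
    \<open>hc\<close>.\<close>
  have hom_K: "csubspace {h. h \<in> K \<and> f h = c * \<alpha> h}"
    if "\<And>s t. s \<in> K \<Longrightarrow> t \<in> K \<Longrightarrow> f (s + t) = f s + f t" "\<And>c s. s \<in> K \<Longrightarrow> f (c *\<^sub>C s) = c * f s" for f c
  proof -
    have "g 0 = 0" if "\<And>c s. s \<in> K \<Longrightarrow> g (c *\<^sub>C s) = c * g s" for g :: "'a \<Rightarrow> complex"
      using that[of 0 0] csubspace_0[OF K(1)] by simp
    from this[of f] this[of \<alpha>] that K(1) show ?thesis
      unfolding csubspace_def cv.subspace_def by (auto simp: \<alpha>_lin algebra_simps)
  qed
  \<comment> \<open>\<open>hc\<close> is only a combination of brackets. Since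
    \<open>\<alpha> hc = 2\<close>, \<alpha> is nonzero on some single bracket, and rescaling
    \<open>x\<close> makes the value 2.\<close>
  obtain x0 y0 where base: "x0 \<in> X" "y0 \<in> Y" "\<alpha> (br x0 y0) = 2"
  proof -
    have "\<exists>x\<in>X. \<exists>y\<in>Y. \<alpha> (br x y) \<noteq> 0"
    proof (rule ccontr)
      assume *: "\<not> ?thesis"
      from hc(1) have "hc \<in> K \<and> \<alpha> hc = 0 * \<alpha> hc"
        by (rule cspan_induct_subspace) (use hom_K[of \<alpha> 0] \<alpha>_lin bracket_K * in auto)
      with hc(2) show False
        by simp
    qed
    then obtain x y where xy: "x \<in> X" "y \<in> Y" "\<alpha> (br x y) \<noteq> 0"
      by blast
    show ?thesis
      by (rule that[of "(2 / \<alpha> (br x y)) *\<^sub>C x" y])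
        (use xy X bracket_K[OF xy(1,2)] in \<open>auto simp: csubspace_scale br \<alpha>_lin\<close>)
  qed
  have "\<eta> (br x y) = \<eta> (br x0 y0) / 2 * \<alpha> (br x y)" if "x \<in> X" "y \<in> Y" for x y
  proof (rule forms_proportional[where A = "\<lambda>x y. \<alpha> (br x y)" and B = "\<lambda>x y. \<eta> (br x y)",
        OF X Y _ _ null base that])
    fix x x' y s
    assume "x \<in> X" "x' \<in> X" "y \<in> Y"
    then show "\<alpha> (br (x + s *\<^sub>C x') y) = \<alpha> (br x y) + s * \<alpha> (br x' y) \<and>
        \<eta> (br (x + s *\<^sub>C x') y) = \<eta> (br x y) + s * \<eta> (br x' y)"
      by (simp add: br bracket_K \<alpha>_lin \<eta>_lin csubspace_scale[OF K(1)])
  next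
    fix x y y' s
    assume "x \<in> X" "y \<in> Y" "y' \<in> Y"
    then show "\<alpha> (br x (y + s *\<^sub>C y')) = \<alpha> (br x y) + s * \<alpha> (br x y') \<and>
        \<eta> (br x (y + s *\<^sub>C y')) = \<eta> (br x y) + s * \<eta> (br x y')"
      by (simp add: br bracket_K \<alpha>_lin \<eta>_lin csubspace_scale[OF K(1)])
  qed
  then have "hc \<in> K \<and> \<eta> hc = \<eta> (br x0 y0) / 2 * \<alpha> hc"
    using bracket_K by (intro cspan_induct_subspace[OF hc(1) hom_K[of \<eta>, OF \<eta>_lin]]) blast+
  \<comment> \<open>The value \<open>\<alpha> hc = 2\<close> cancels the denominator, so
    \<open>hc\<close> inherits integrality from the sl2-triple of \<open>x0\<close> and
    \<open>y0\<close>.\<close>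
  with hc(2) have "\<eta> hc = \<eta> (br x0 y0)"
    by simp
  with integral[OF base] not_int show False
    by simp
qed

end
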